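(* Let $n\ge4$ and define $\varepsilon(n):=\log_2\!\left(1+\frac1{n-2}\right)$. If $A\in\mathbb R^{n\times n}$ is a symmetric matrix with zero diagonal and positive off-diagonal entries satisfying the $\mathbb T_q$-inequalities for some $0<q\le\varepsilon(n)$, then $A$ is Lorentzian.
   Context: For $q>0$, a symmetric $n\times n$ real matrix $A$ with zero diagonal and positive off-diagonal entries satisfies the $\mathbb T_q$-inequalities if for all $1\le i<j<k<\ell\le n$ the three numbers $(A_{ij}A_{k\ell})^{1/q}$, $(A_{ik}A_{j\ell})^{1/q}$, $(A_{i\ell}A_{jk})^{1/q}$ are the side lengths of a (possibly degenerate) Euclidean triangle, i.e. each is at most the sum of the other two. A real symmetric matrix is Lorentzian if all its entries are nonnegative and it has at most one positive eigenvalue (counted with multiplicity). *)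

theory Defs
  imports Complex_Main "Jordan_Normal_Form.Char_Poly"
begin

text \<open>Rows and columns of a matrix are numbered from \<open>0\<close>, so the indices \<open>1, \<dots>, n\<close> of the
  mathematical text become \<open>0, \<dots>, n - 1\<close>.\<close>

definition triangle_sides :: "real \<Rightarrow> real \<Rightarrow> real \<Rightarrow> bool" where
  "triangle_sides a b c \<longleftrightarrow> a \<le> b + c \<and> b \<le> a + c \<and> c \<le> a + b"

definition Tq_inequalities :: "real \<Rightarrow> real mat \<Rightarrow> bool" where
  "Tq_inequalities q A \<longleftrightarrow>
     (\<forall>i j k l. i < j \<and> j < k \<and> k < l \<and> l < dim_row A \<longrightarrow>
        triangle_sides ((A $$ (i, j) * A $$ (k, l)) powr (1 / q))
                       ((A $$ (i, k) * A $$ (j, l)) powr (1 / q))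
                       ((A $$ (i, l) * A $$ (j, k)) powr (1 / q)))"

text \<open>An eigenvalue is counted with its multiplicity as a root of the characteristic polynomial;
  for a real symmetric matrix this is also the dimension of its eigenspace. The sum is over a
  finite set.\<close>

definition num_pos_eigenvalues :: "real mat \<Rightarrow> nat" where
  "num_pos_eigenvalues A = (\<Sum>x \<in> {x. eigenvalue A x \<and> 0 < x}. Polynomial.order x (char_poly A))"

definition lorentzian :: "real mat \<Rightarrow> bool" where
  "lorentzian A \<longleftrightarrow> square_mat A \<and> transpose_mat A = A \<and>
     (\<forall>i < dim_row A. \<forall>j < dim_row A. 0 \<le> A $$ (i, j)) \<and>
     num_pos_eigenvalues A \<le> 1"

definition eps :: "nat \<Rightarrow> real" where
  "eps n = log 2 (1 + 1 / (real n - 2))"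

end

theory Submission
  imports Defs "HOL-Analysis.Convex" "Jordan_Normal_Form.Schur_Decomposition"
begin

text \<open>
  Row and column scaling preserves the signature, so row \<open>0\<close> may be scaled to be constantly \<open>1\<close>
  off the diagonal. What remains is the matrix \<open>B i j = A i j / (A 0 i * A 0 j)\<close> on the other
  \<open>n - 1\<close> indices, and the \<open>T\<^sub>q\<close>-inequalities that involve index \<open>0\<close> say that \<open>B powr (1 / q)\<close>
  is a metric. If \<open>B\<close> is of negative type, that is \<open>z\<^sup>T B z \<le> 0\<close> whenever the entries of \<open>z\<close> sum
  to \<open>0\<close>, then \<open>A\<close> is negative semidefinite on the hyperplane orthogonal to its row \<open>0\<close>, and hence
  has at most one positive eigenvalue (lemma \<open>at_most_one_positive_eigenvalue\<close>).

  By concavity, the \<open>q\<close>-th power \<open>B\<close> of a metric is nearly ultrametric: on each triple the largest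
  value is at most the middle one plus \<open>e = 2 powr q - 1\<close> times the smallest, and \<open>q \<le> eps n\<close> says
  \<open>e \<le> 1 / (n - 2)\<close>. It remains to show that such a \<open>B\<close> on \<open>N\<close> points is of negative type if
  \<open>e * (N - 2) \<le> 2\<close> (lemma \<open>near_ultrametric_negative_type\<close>).

  Let \<open>z\<close> have sum \<open>0\<close>. Cancel charges of opposite sign greedily, each time between a closest such
  pair, until nothing is left. When the pair has distance \<open>W\<close>, every other charge is at distance at
  least \<open>W\<close> from the member of opposite sign, so its potential difference across the pair is
  bounded on the bad side by \<open>e * W\<close>. This makes the loss of energy \<open>- z\<^sup>T B z / 2\<close> at least \<open>W\<close>
  times the loss of
  \<open>Q z = (1 + e) / 2 * (\<Sum> z\<^sup>2) - e / 4 * (\<Sum> \<bar>z\<bar>)\<^sup>2\<close>.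
  The Cauchy-Schwarz inequality gives \<open>Q \<ge> 0\<close>, and the distances \<open>W\<close> do not decrease
  along the process. Summation by parts then shows that the energy is nonnegative; in lemma
  \<open>energy_ge\<close> this takes the form of an induction that proves energy \<open>\<ge> w * Q z\<close>, where \<open>w\<close> is any
  nonnegative lower bound for the distances between charges of opposite sign.
\<close>

(* From here on, the bullet denotes scalar_prod on vectors only. *)
unbundle no inner_syntax

section \<open>Near-ultrametrics are of negative type\<close>

text \<open>A weakened ultrametric inequality: the largest of the three values on a triple exceeds the
  middle one by at most \<open>e\<close> times the smallest. With \<open>e = 0\<close> this is the ultrametric inequality.
  The third clause is stated without ordering all three values; for \<open>e \<ge> 0\<close> it says the
  same, because it is trivial unless \<open>B i k\<close> is the largest of them. Distinct points may be at
  distance \<open>0\<close>.\<close>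

definition near_ultrametric_on :: "'a set \<Rightarrow> real \<Rightarrow> ('a \<Rightarrow> 'a \<Rightarrow> real) \<Rightarrow> bool" where
  "near_ultrametric_on S e B \<longleftrightarrow>
     (\<forall>i\<in>S. \<forall>j\<in>S. 0 \<le> B i j \<and> B i j = B j i) \<and> (\<forall>i\<in>S. B i i = 0) \<and>
     (\<forall>i\<in>S. \<forall>j\<in>S. \<forall>k\<in>S. B i j \<le> B j k \<longrightarrow> B i k \<le> B j k + e * B i j)"

text \<open>The form \<open>- x\<^sup>T B x / 2\<close>, with the sum over ordered pairs. \<open>B\<close> is of negative type when this
  is nonnegative on the vectors of sum \<open>0\<close>.\<close>

definition energy :: "'a set \<Rightarrow> ('a \<Rightarrow> 'a \<Rightarrow> real) \<Rightarrow> ('a \<Rightarrow> real) \<Rightarrow> real" where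
  "energy S B x = - (\<Sum>i\<in>S. \<Sum>j\<in>S. B i j * x i * x j) / 2"

text \<open>On vectors of sum \<open>0\<close> this is the energy of the extremal near-ultrametric at a single scale,
  in which two entries are at distance \<open>1 + e\<close> if they have the same sign and at distance \<open>1\<close> if
  they have opposite signs.\<close>

definition comparison_form :: "'a set \<Rightarrow> real \<Rightarrow> ('a \<Rightarrow> real) \<Rightarrow> real" where
  "comparison_form S e x = (1 + e) / 2 * (\<Sum>i\<in>S. (x i)\<^sup>2) - e / 4 * (\<Sum>i\<in>S. \<bar>x i\<bar>)\<^sup>2"

lemma comparison_form_nonneg:
  assumes "finite S" "0 \<le> e" "e * (real (card S) - 2) \<le> 2"
  shows "0 \<le> comparison_form S e x"
proof -
  have "(\<Sum>i\<in>S. \<bar>x i\<bar>)\<^sup>2 \<le> (\<Sum>i\<in>S. (x i)\<^sup>2) * real (card S)"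
    using sum_squared_le_sum_of_squares[of "\<lambda>i. \<bar>x i\<bar>" S] assms(1) by simp
  hence "e / 4 * (\<Sum>i\<in>S. \<bar>x i\<bar>)\<^sup>2 \<le> e / 4 * ((\<Sum>i\<in>S. (x i)\<^sup>2) * real (card S))"
    using assms(2) by (intro mult_left_mono) auto
  also have "\<dots> = (e * real (card S)) / 4 * (\<Sum>i\<in>S. (x i)\<^sup>2)" by simp
  also have "\<dots> \<le> (1 + e) / 2 * (\<Sum>i\<in>S. (x i)\<^sup>2)"
    using assms(3) by (intro mult_right_mono sum_nonneg) (auto simp: algebra_simps)
  finally show ?thesis unfolding comparison_form_def by linarith
qed

lemma sum_split_two:
  fixes f :: "'a \<Rightarrow> real"
  assumes "finite S" "i \<in> S" "j \<in> S" "i \<noteq> j"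
  shows "sum f S = f i + f j + sum f (S - {i, j})"
proof -
  have "sum f S = f i + sum f (S - {i})" using assms by (simp add: sum.remove)
  also have "sum f (S - {i}) = f j + sum f (S - {i} - {j})"
    using assms by (intro sum.remove) auto
  also have "S - {i} - {j} = S - {i, j}" by auto
  finally show ?thesis by simp
qed

text \<open>The effect on the energy of moving the amount \<open>d\<close> from the point \<open>j\<close> to the point \<open>i\<close>.\<close>

lemma energy_dipole:
  assumes S: "finite S" "i \<in> S" "j \<in> S" "i \<noteq> j"
    and B: "near_ultrametric_on S e B"
    and x: "x = (\<lambda>k. y k + d * (of_bool (k = i) - of_bool (k = j)))"
  shows "energy S B x =
    energy S B y + d * (\<Sum>k\<in>S. (B j k - B i k) * y k) + d\<^sup>2 * B i j"
proof -
  define h where "h = (\<lambda>k. of_bool (k = i) - of_bool (k = j) :: real)"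
  have sym: "B a b = B b a" if "a \<in> S" "b \<in> S" for a b
    using B that unfolding near_ultrametric_on_def by blast
  have Bi: "B i i = 0" "B j j = 0" using B S unfolding near_ultrametric_on_def by auto
  have sh: "(\<Sum>k\<in>S. f k * h k) = f i - f j" for f :: "'a \<Rightarrow> real"
    using S by (subst sum_split_two[of S i j]) (auto simp: h_def)
  define Z where "Z = (\<Sum>k\<in>S. (B i k - B j k) * y k)"
  have xh: "x k = y k + d * h k" for k unfolding x h_def ..
  have 1: "(\<Sum>a\<in>S. \<Sum>b\<in>S. B a b * y a * h b) = Z"
  proof -
    have "(\<Sum>a\<in>S. \<Sum>b\<in>S. B a b * y a * h b) = (\<Sum>a\<in>S. B a i * y a - B a j * y a)"
      by (simp only: sh)
    also have "\<dots> = Z" unfolding Z_def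
      by (intro sum.cong) (auto simp: algebra_simps sym S)
    finally show ?thesis .
  qed
  have 2: "(\<Sum>a\<in>S. \<Sum>b\<in>S. B a b * h a * y b) = Z"
  proof -
    have "(\<Sum>a\<in>S. \<Sum>b\<in>S. B a b * h a * y b) = (\<Sum>b\<in>S. \<Sum>a\<in>S. B a b * h a * y b)"
      by (rule sum.swap)
    also have "\<dots> = (\<Sum>b\<in>S. \<Sum>a\<in>S. (B a b * y b) * h a)" by (simp add: mult_ac)
    also have "\<dots> = Z" unfolding Z_def by (simp only: sh) (simp add: algebra_simps)
    finally show ?thesis .
  qed
  have 3: "(\<Sum>a\<in>S. \<Sum>b\<in>S. B a b * h a * h b) = - 2 * B i j"
  proof -
    have "(\<Sum>a\<in>S. \<Sum>b\<in>S. B a b * h a * h b) = (\<Sum>a\<in>S. (B a i - B a j) * h a)"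
      by (intro sum.cong refl) (simp only: sh left_diff_distrib)
    also have "\<dots> = - 2 * B i j" using sym[of i j] S by (simp only: sh) (simp add: Bi)
    finally show ?thesis .
  qed
  have Z: "(\<Sum>k\<in>S. (B j k - B i k) * y k) = - Z"
    unfolding Z_def sum_negf[symmetric] by (intro sum.cong) (auto simp: algebra_simps)
  have "(\<Sum>a\<in>S. \<Sum>b\<in>S. B a b * x a * x b) =
      (\<Sum>a\<in>S. \<Sum>b\<in>S. B a b * y a * y b + d * (B a b * y a * h b) + d * (B a b * h a * y b)
         + d\<^sup>2 * (B a b * h a * h b))"
    by (intro sum.cong refl) (simp add: xh algebra_simps power2_eq_square)
  also have "\<dots> = (\<Sum>a\<in>S. \<Sum>b\<in>S. B a b * y a * y b) + 2 * d * Z - 2 * d\<^sup>2 * B i j"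
    by (simp add: sum.distrib sum_distrib_left[symmetric] 1 2 3)
  finally show ?thesis
    unfolding energy_def Z by (simp add: field_simps)
qed

text \<open>The main estimate, by induction on the support of \<open>x\<close>. A closest pair of points of opposite sign
  is discharged against each other until one of them vanishes. As every other point of the support
  is at distance at least \<open>W\<close>, the distance of the pair, from whichever of the two has the opposite
  sign, the near-ultrametric inequality bounds the change of the energy from below by \<open>W\<close> times the change of the comparison form. The
  claim carries a lower bound \<open>w\<close> for the distances between points of opposite sign, because the
  induction hypothesis is needed with \<open>w = W\<close> and not only with \<open>w = 0\<close>.\<close>

lemma energy_ge:
  assumes S: "finite S" and e: "0 \<le> e" "e * (real (card S) - 2) \<le> 2"
    and B: "near_ultrametric_on S e B"
    and "(\<Sum>k\<in>S. x k) = 0"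
    and "0 \<le> w" "\<And>i j. i \<in> S \<Longrightarrow> j \<in> S \<Longrightarrow> 0 < x i \<Longrightarrow> x j < 0 \<Longrightarrow> w \<le> B i j"
  shows "w * comparison_form S e x \<le> energy S B x"
  using assms(5-)
proof (induction "card {k \<in> S. x k \<noteq> 0}" arbitrary: x w rule: less_induct)
  case less
  note sum0 = less.prems(1)
  have Bnn: "0 \<le> B a b" and sym: "B a b = B b a" if "a \<in> S" "b \<in> S" for a b
    using B that unfolding near_ultrametric_on_def by auto
  have B0: "B a a = 0" if "a \<in> S" for a
    using B that unfolding near_ultrametric_on_def by auto
  have tri: "B a c \<le> B b c + e * B a b" if "a \<in> S" "b \<in> S" "c \<in> S" "B a b \<le> B b c" for a b c
    using B that unfolding near_ultrametric_on_def by blast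
  show ?case
  proof (cases "\<forall>k\<in>S. x k = 0")
    case True
    thus ?thesis by (simp add: comparison_form_def energy_def)
  next
    case False
    define P where "P = {k \<in> S. 0 < x k} \<times> {k \<in> S. x k < 0}"
    have "finite P" unfolding P_def using S by auto
    have "\<exists>k\<in>S. 0 < x k"
    proof (rule ccontr)
      assume "\<not> ?thesis"
      hence "\<forall>k\<in>S. - x k \<ge> 0" by force
      moreover have "(\<Sum>k\<in>S. - x k) = 0" using sum0 by (simp add: sum_negf)
      ultimately have "\<forall>k\<in>S. - x k = 0" using S by (subst (asm) sum_nonneg_eq_0_iff) auto
      thus False using False by auto
    qed
    moreover have "\<exists>k\<in>S. x k < 0"
    proof (rule ccontr)
      assume "\<not> ?thesis"
      hence "\<forall>k\<in>S. x k \<ge> 0" by force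
      hence "\<forall>k\<in>S. x k = 0" using S sum0 by (subst (asm) sum_nonneg_eq_0_iff) auto
      thus False using False by auto
    qed
    ultimately have "P \<noteq> {}" unfolding P_def by auto
    obtain p where p: "is_arg_min (\<lambda>(i, j). B i j) (\<lambda>p. p \<in> P) p"
      using ex_is_arg_min_if_finite[OF \<open>finite P\<close> \<open>P \<noteq> {}\<close>] by blast
    obtain i j where pij: "p = (i, j)" by (cases p)
    have ij: "i \<in> S" "j \<in> S" "0 < x i" "x j < 0"
      using p unfolding pij is_arg_min_def P_def by auto
    define W where "W = B i j"
    have closest: "W \<le> B a b" if "a \<in> S" "b \<in> S" "0 < x a" "x b < 0" for a b
      using p that unfolding pij is_arg_min_def P_def W_def by force
    have "i \<noteq> j" using ij by auto
    have "W \<ge> 0" unfolding W_def using Bnn ij by auto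
    have "w \<le> W" unfolding W_def using less.prems(3) ij by blast
    \<comment> \<open>The largest amount that can be discharged without changing a sign; it makes \<open>y i\<close> or \<open>y j\<close>
      vanish.\<close>
    define d where "d = min (x i) (- x j)"
    have "d > 0" "d \<le> x i" "d \<le> - x j" unfolding d_def using ij by auto
    define y where "y = (\<lambda>k. x k - d * (of_bool (k = i) - of_bool (k = j)))"
    have xy: "x = (\<lambda>k. y k + d * (of_bool (k = i) - of_bool (k = j)))" unfolding y_def by auto
    have yi: "y i = x i - d" "y j = x j + d" "0 \<le> y i" "y j \<le> 0"
      using \<open>i \<noteq> j\<close> \<open>d \<le> x i\<close> \<open>d \<le> - x j\<close> unfolding y_def by auto
    have yk: "y k = x k" if "k \<noteq> i" "k \<noteq> j" for k using that unfolding y_def by auto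
    define R where "R = S - {i, j}"
    note split = sum_split_two[OF S ij(1,2) \<open>i \<noteq> j\<close>, folded R_def]
    have sumR: "(\<Sum>k\<in>R. f (x k)) = (\<Sum>k\<in>R. f (y k))" for f :: "real \<Rightarrow> real"
      by (intro sum.cong) (auto simp: R_def yk)
    have "(\<Sum>k\<in>S. y k) = 0"
      using sum0 sumR[of "\<lambda>t. t"] unfolding split yi by simp
    have pos: "0 < x k" if "0 < y k" for k
      using that ij yi yk by (cases "k = i"; cases "k = j") auto
    have neg: "x k < 0" if "y k < 0" for k
      using that ij yi yk by (cases "k = i"; cases "k = j") auto
    have "card {k \<in> S. y k \<noteq> 0} < card {k \<in> S. x k \<noteq> 0}"
    proof (rule psubset_card_mono)
      have "y i = 0 \<or> y j = 0" unfolding yi d_def by auto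
      hence "{k \<in> S. y k \<noteq> 0} \<noteq> {k \<in> S. x k \<noteq> 0}" using ij by force
      moreover have "{k \<in> S. y k \<noteq> 0} \<subseteq> {k \<in> S. x k \<noteq> 0}"
        using pos neg by (force simp: neq_iff)
      ultimately show "{k \<in> S. y k \<noteq> 0} \<subset> {k \<in> S. x k \<noteq> 0}" by blast
    qed (use S in auto)
    from less.hyps[OF this \<open>(\<Sum>k\<in>S. y k) = 0\<close> \<open>W \<ge> 0\<close>]
    have IH: "W * comparison_form S e y \<le> energy S B y"
      using closest pos neg by blast
    define L where "L = (\<Sum>k\<in>R. \<bar>y k\<bar>)"
    \<comment> \<open>If \<open>y k\<close> is nonzero, the point among \<open>i\<close> and \<open>j\<close> whose sign is opposite to that of
      \<open>y k\<close> is at distance at least \<open>W\<close> from \<open>k\<close>, so the other one is farther from \<open>k\<close> by at most \<open>e * W\<close>.\<close>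
    have step: "- (e * W * \<bar>y k\<bar>) \<le> (B j k - B i k) * y k" if "k \<in> R" for k
    proof -
      have k: "k \<in> S" "k \<noteq> i" "k \<noteq> j" using that unfolding R_def by auto
      consider "y k = 0" | "0 < y k" | "y k < 0" by linarith
      thus ?thesis
      proof cases
        case 2
        have "W \<le> B j k" using closest[of k j] 2 k ij yk sym[of j k] by simp
        hence "B i k \<le> B j k + e * W" using tri[of i j k] k ij unfolding W_def by simp
        hence "(- (e * W)) * y k \<le> (B j k - B i k) * y k"
          using 2 by (intro mult_right_mono) auto
        thus ?thesis using 2 by simp
      next
        case 3
        have "W \<le> B i k" using closest[of i k] 3 k ij yk by simp
        hence "B j k \<le> B i k + e * W"
          using tri[of j i k] k ij sym[of i j] unfolding W_def by simp
        hence "(e * W) * y k \<le> (B j k - B i k) * y k"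
          using 3 by (intro mult_right_mono_neg) auto
        thus ?thesis using 3 by simp
      qed auto
    qed
    have "- (e * W * L) = (\<Sum>k\<in>R. - (e * W * \<bar>y k\<bar>))"
      unfolding L_def by (simp add: sum_negf sum_distrib_left)
    also have "\<dots> \<le> (\<Sum>k\<in>R. (B j k - B i k) * y k)" by (intro sum_mono step)
    finally have "W * (y i - y j) - e * W * L \<le> (\<Sum>k\<in>S. (B j k - B i k) * y k)"
      unfolding split using sym[of i j] B0 ij by (simp add: W_def algebra_simps)
    hence "d * (W * (y i - y j) - e * W * L) + d\<^sup>2 * W \<le>
        energy S B x - energy S B y"
      using energy_dipole[OF S ij(1,2) \<open>i \<noteq> j\<close> B xy] \<open>d > 0\<close> unfolding W_def by simp
    \<comment> \<open>The comparison form is chosen so that this is an equality.\<close>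
    moreover have "W * (comparison_form S e x - comparison_form S e y) =
        d * (W * (y i - y j) - e * W * L) + d\<^sup>2 * W"
    proof -
      have abs: "\<bar>x i\<bar> = y i + d" "\<bar>x j\<bar> = d - y j" "\<bar>y i\<bar> = y i" "\<bar>y j\<bar> = - y j"
        "x i = y i + d" "x j = y j - d"
        using yi ij by auto
      show ?thesis
        unfolding comparison_form_def split sumR[of abs] sumR[of "\<lambda>t. t\<^sup>2"] L_def[symmetric] abs(1-4)
        unfolding abs(5,6) by (simp add: field_simps power2_eq_square)
    qed
    ultimately have "W * comparison_form S e x \<le> energy S B x"
      using IH by (simp add: algebra_simps)
    moreover have "w * comparison_form S e x \<le> W * comparison_form S e x"
      using \<open>w \<le> W\<close> comparison_form_nonneg[OF S e] by (rule mult_right_mono)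
    ultimately show ?thesis by linarith
  qed
qed

lemma near_ultrametric_negative_type:
  assumes S: "finite S" and e: "0 \<le> e" "e * (real (card S) - 2) \<le> 2"
    and B: "near_ultrametric_on S e B" and x: "(\<Sum>k\<in>S. x k) = 0"
  shows "(\<Sum>i\<in>S. \<Sum>j\<in>S. B i j * x i * x j) \<le> 0"
proof -
  have "0 * comparison_form S e x \<le> energy S B x"
    using B by (intro energy_ge[OF S e B x]) (auto simp: near_ultrametric_on_def)
  thus ?thesis unfolding energy_def by simp
qed

section \<open>Symmetric matrices that are negative semidefinite on a hyperplane\<close>

lemma symmetric_scalar_prod:
  fixes A :: "real mat"
  assumes A: "A \<in> carrier_mat n n" "transpose_mat A = A"
    and v: "v \<in> carrier_vec n" and w: "w \<in> carrier_vec n"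
  shows "v \<bullet> (A *\<^sub>v w) = (A *\<^sub>v v) \<bullet> w"
  using transpose_vec_mult_scalar[OF A(1) w v] A(2) by simp

lemma scalar_prod_self_pos:
  fixes v :: "real vec"
  assumes "v \<in> carrier_vec n" "v \<noteq> 0\<^sub>v n"
  shows "0 < v \<bullet> v"
  using conjugate_square_greater_0_vec[OF assms(1)] assms(2) by simp

text \<open>The deflation step of the spectral theorem. In an orthogonal basis \<open>W\<close> that starts with \<open>v\<close>, the
  first column of the transformed matrix \<open>C\<close> is \<open>e\<close> times the first unit vector, so a root of order at least two is
  still a root for the lower right block \<open>C3\<close>. An eigenvector \<open>u\<close> of that block, extended by a
  leading \<open>0\<close>, gives \<open>w\<close> orthogonal to \<open>v\<close> with \<open>A w = e w + c v\<close>, and \<open>c = 0\<close> by symmetry.\<close>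

lemma orthogonal_eigenvector_of_multiple_root:
  fixes A :: "real mat"
  assumes A: "A \<in> carrier_mat n n" "transpose_mat A = A"
    and v: "eigenvector A v e" and ord: "2 \<le> Polynomial.order e (char_poly A)"
  shows "\<exists>w. eigenvector A w e \<and> v \<bullet> w = 0"
proof -
  have vn: "v \<in> carrier_vec n" and v0: "v \<noteq> 0\<^sub>v n" and Av: "A *\<^sub>v v = e \<cdot>\<^sub>v v"
    using v A unfolding eigenvector_def by auto
  have n: "n \<noteq> 0" using vn v0 by auto
  define m where "m = n - 1"
  interpret cof_vec_space n "TYPE(real)" .
  define b where "b = basis_completion v"
  define ws where "ws = gram_schmidt n b"
  define W where "W = mat_of_cols n ws"
  define V where "V = corthogonal_inv W"
  define C where "C = V * A * W"
  from basis_completion[OF vn v0, folded b_def]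
  have b: "distinct b" "\<not> lin_dep (set b)" "set b \<subseteq> carrier_vec n" "hd b = v" "length b = n"
    by auto
  then obtain vs where bv: "b = v # vs" using n by (cases b) auto
  have ws: "set ws \<subseteq> carrier_vec n" "corthogonal ws" "length ws = n"
    using gram_schmidt_result[OF b(3,1,2) refl, folded ws_def] b(5) by auto
  have hd: "hd ws = v" using gram_schmidt_hd[OF vn, of vs, folded bv] unfolding ws_def .
  have W: "W \<in> carrier_mat n n" using ws unfolding W_def by auto
  have V: "V \<in> carrier_mat n n"
    using W unfolding V_def corthogonal_inv_def by (auto simp: mat_of_rows_def)
  have VW: "V * W = 1\<^sub>m n"
    using corthogonal_inv_result[OF orthogonal_mat_of_cols[OF ws]] W V
    unfolding V_def W_def inverts_mat_def by simp
  have WV: "W * V = 1\<^sub>m n" by (rule mat_mult_left_right_inverse[OF V W VW])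
  have C: "C \<in> carrier_mat n n" using V W A unfolding C_def by auto
  have "similar_mat C A"
    unfolding similar_mat_def
    by (intro exI[of _ V] exI[of _ W], rule similar_mat_witI[of _ _ n]) (use W V A C VW WV in \<open>auto simp: C_def\<close>)
  hence cp: "char_poly C = char_poly A" by (rule char_poly_similar)
  have col0: "col C 0 = vec n (\<lambda>i. if i = 0 then e else 0)"
    unfolding C_def V_def W_def by (rule corthogonal_col_ev_0[OF A(1) vn v0 Av n hd ws])
  obtain C1 C2 C0 C3 where split: "split_block C 1 1 = (C1, C2, C0, C3)"
    by (cases "split_block C 1 1") auto
  have dims: "dim_row C = 1 + m" "dim_col C = 1 + m" using C n unfolding m_def by auto
  note sb = split_block[OF split dims]
  have C00: "C $$ (0, 0) = e" using arg_cong[OF col0, of "\<lambda>v. v $ 0"] C n by simp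
  have Ci0: "C $$ (Suc i, 0) = 0" if "i < m" for i
    using arg_cong[OF col0, of "\<lambda>v. v $ Suc i"] C that unfolding m_def by simp
  have C1: "C1 = mat 1 1 (\<lambda>_. e)"
    using split C00 by (auto simp: split_block_def Let_def)
  have C0: "C0 = 0\<^sub>m m 1"
    using split Ci0 dims by (auto simp: split_block_def Let_def)
  have "char_poly C = char_poly C1 * char_poly C3"
    using char_poly_four_block_zeros_col[OF sb(1,2,4)] sb(5) C0 by simp
  also have "char_poly C1 = [:- e, 1:]" by (simp add: C1 char_poly_defs det_def sign_def)
  finally have cp3: "char_poly A = [:- e, 1:] * char_poly C3" unfolding cp .
  have "char_poly A \<noteq> 0" using degree_monic_char_poly[OF A(1)] by auto
  hence "Polynomial.order e (char_poly A) = Polynomial.order e [:- e, 1:] + Polynomial.order e (char_poly C3)"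
    unfolding cp3 by (rule order_mult)
  moreover have "Polynomial.order e [:- e, 1:] = 1"
    using order_power_n_n[of e 1] by simp
  ultimately have "poly (char_poly C3) e = 0" using ord by (subst order_root) linarith
  hence "eigenvalue C3 e" using eigenvalue_root_char_poly[OF sb(4)] by simp
  then obtain u where u: "u \<in> carrier_vec m" "u \<noteq> 0\<^sub>v m" "C3 *\<^sub>v u = e \<cdot>\<^sub>v u"
    using sb(4) unfolding eigenvalue_def eigenvector_def by auto
  define z where "z = vec n (\<lambda>i. if i = 0 then 0 else u $ (i - 1))"
  have z: "z \<in> carrier_vec n" unfolding z_def by simp
  have zu: "z $ Suc i = u $ i" if "i < m" for i using that unfolding z_def m_def by simp
  have z0: "z $ 0 = 0" using n unfolding z_def by simp
  have "z \<noteq> 0\<^sub>v n"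
  proof
    assume "z = 0\<^sub>v n"
    hence "u $ i = 0" if "i < m" for i using zu[OF that] that unfolding m_def by simp
    hence "u = 0\<^sub>v m" using u(1) by (intro eq_vecI) auto
    thus False using u(2) by simp
  qed
  define c where "c = (C *\<^sub>v z) $ 0"
  have Cz: "C *\<^sub>v z = e \<cdot>\<^sub>v z + c \<cdot>\<^sub>v unit_vec n 0"
  proof (rule eq_vecI)
    fix i assume "i < dim_vec (e \<cdot>\<^sub>v z + c \<cdot>\<^sub>v unit_vec n 0)"
    hence i: "i < n" using z by simp
    show "(C *\<^sub>v z) $ i = (e \<cdot>\<^sub>v z + c \<cdot>\<^sub>v unit_vec n 0) $ i"
    proof (cases i)
      case 0
      thus ?thesis using i z z0 by (simp add: c_def)
    next
      case (Suc k)
      hence k: "k < m" using i unfolding m_def by simp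
      have n_m: "n = Suc m" using n unfolding m_def by simp
      have C3: "C3 $$ (k, l) = C $$ (i, Suc l)" if "l < m" for l
        using split that k dims Suc by (auto simp: split_block_def Let_def)
      have "(C *\<^sub>v z) $ i = (\<Sum>l<n. C $$ (i, l) * z $ l)"
        using i C z by (simp add: scalar_prod_def lessThan_atLeast0)
      also have "\<dots> = (\<Sum>l<m. C3 $$ (k, l) * u $ l)"
        unfolding n_m by (subst sum.lessThan_Suc_shift) (auto simp: z0 zu C3 intro!: sum.cong)
      also have "\<dots> = (C3 *\<^sub>v u) $ k"
        using k sb(4) u(1) by (simp add: scalar_prod_def lessThan_atLeast0)
      also have "\<dots> = e * z $ i" using k u zu Suc by simp
      finally show ?thesis using i z Suc by simp
    qed
  qed (use C z in auto)
  define w where "w = W *\<^sub>v z"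
  have w: "w \<in> carrier_vec n" unfolding w_def using W z by simp
  have "w \<noteq> 0\<^sub>v n"
  proof
    assume "w = 0\<^sub>v n"
    moreover have "V *\<^sub>v w = z"
      unfolding w_def using assoc_mult_mat_vec[OF V W z] VW z by simp
    moreover have "V *\<^sub>v 0\<^sub>v n = 0\<^sub>v n" using V by (intro eq_vecI) auto
    ultimately show False using \<open>z \<noteq> 0\<^sub>v n\<close> by simp
  qed
  have "ws ! 0 = v" using hd ws(3) n by (cases ws) auto
  hence W0: "col W 0 = v" using ws(3) n vn by (simp add: W_def)
  have vw: "v \<bullet> w = 0"
  proof -
    have "(W\<^sup>T *\<^sub>v v) $ k * z $ k = 0" if "k < n" for k
    proof (cases "k = 0")
      case False
      have "col W k \<bullet> col W 0 = 0"
        using corthogonal_matD[OF orthogonal_mat_of_cols[OF ws], folded W_def, of k 0] False that W n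
        by simp
      thus ?thesis using that W W0 by simp
    qed (simp add: z0)
    hence "(W\<^sup>T *\<^sub>v v) \<bullet> z = 0"
      using z unfolding scalar_prod_def by (intro sum.neutral) simp
    thus ?thesis unfolding w_def using transpose_vec_mult_scalar[OF W z vn] by simp
  qed
  have Aw: "A *\<^sub>v w = e \<cdot>\<^sub>v w + c \<cdot>\<^sub>v v"
  proof -
    have "W * C = W * V * (A * W)"
      unfolding C_def using W V A by (simp add: assoc_mult_mat[of _ n n _ n _ n])
    hence AW: "A * W = W * C" using WV A W by simp
    have "A *\<^sub>v w = (A * W) *\<^sub>v z"
      unfolding w_def using assoc_mult_mat_vec[OF A(1) W z] by simp
    also have "\<dots> = W *\<^sub>v (C *\<^sub>v z)" unfolding AW by (rule assoc_mult_mat_vec[OF W C z])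
    also have "\<dots> = e \<cdot>\<^sub>v w + c \<cdot>\<^sub>v (W *\<^sub>v unit_vec n 0)"
      unfolding Cz w_def using W z
      by (simp add: mult_add_distrib_mat_vec[of _ n n] mult_mat_vec[of _ n n])
    also have "W *\<^sub>v unit_vec n 0 = v"
      using W n unfolding W0[symmetric] by (intro eq_vecI) auto
    finally show ?thesis .
  qed
  have "0 = v \<bullet> (A *\<^sub>v w)"
    using symmetric_scalar_prod[OF A vn w] Av vw vn w by simp
  also have "\<dots> = c * (v \<bullet> v)"
    unfolding Aw using vn w vw by (simp add: scalar_prod_add_distrib[of _ n])
  finally have "c = 0" using scalar_prod_self_pos[OF vn v0] by simp
  hence "A *\<^sub>v w = e \<cdot>\<^sub>v w" using Aw w vn by simp
  thus ?thesis using w \<open>w \<noteq> 0\<^sub>v n\<close> vw A unfolding eigenvector_def by auto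
qed

text \<open>Two positive eigenvalues, distinct or not, would come with orthogonal eigenvectors. Their span
  contains a nonzero vector orthogonal to \<open>l\<close>, while the form is positive on the span away from
  \<open>0\<close>.\<close>

lemma at_most_one_positive_eigenvalue:
  fixes A :: "real mat"
  assumes A: "A \<in> carrier_mat n n" "transpose_mat A = A" and l: "l \<in> carrier_vec n"
    and neg: "\<And>x. x \<in> carrier_vec n \<Longrightarrow> l \<bullet> x = 0 \<Longrightarrow> x \<bullet> (A *\<^sub>v x) \<le> 0"
  shows "num_pos_eigenvalues A \<le> 1"
proof -
  have no_pair: False
    if v: "eigenvector A v a" and w: "eigenvector A w b" and ab: "0 < a" "0 < b"
      and vw: "v \<bullet> w = 0" for v w a b
  proof -
    have vn: "v \<in> carrier_vec n" "v \<noteq> 0\<^sub>v n" "A *\<^sub>v v = a \<cdot>\<^sub>v v"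
      and wn: "w \<in> carrier_vec n" "w \<noteq> 0\<^sub>v n" "A *\<^sub>v w = b \<cdot>\<^sub>v w"
      using v w A unfolding eigenvector_def by auto
    \<comment> \<open>Coefficients of a nonzero vector of the span in the hyperplane.\<close>
    obtain s t where st: "s * (l \<bullet> v) + t * (l \<bullet> w) = 0" "s \<noteq> 0 \<or> t \<noteq> 0"
    proof (cases "l \<bullet> v = 0")
      case True thus ?thesis using that[of 1 0] by simp
    next
      case False thus ?thesis using that[of "l \<bullet> w" "- (l \<bullet> v)"] by simp
    qed
    define x where "x = s \<cdot>\<^sub>v v + t \<cdot>\<^sub>v w"
    have x: "x \<in> carrier_vec n" unfolding x_def using vn wn by simp
    have wv: "w \<bullet> v = 0" using vw comm_scalar_prod[OF vn(1) wn(1)] by simp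
    have "l \<bullet> x = 0"
      using st l vn wn unfolding x_def by (simp add: scalar_prod_add_distrib[of _ n])
    hence "x \<bullet> (A *\<^sub>v x) \<le> 0" by (rule neg[OF x])
    moreover have "A *\<^sub>v x = (s * a) \<cdot>\<^sub>v v + (t * b) \<cdot>\<^sub>v w"
      unfolding x_def using A vn wn
      by (simp add: mult_add_distrib_mat_vec[of _ n n] mult_mat_vec[of _ n n] smult_smult_assoc)
    hence "x \<bullet> (A *\<^sub>v x) = s\<^sup>2 * a * (v \<bullet> v) + t\<^sup>2 * b * (w \<bullet> w)"
      unfolding x_def using vn wn vw wv
      by (simp add: scalar_prod_add_distrib[of _ n] add_scalar_prod_distrib[of _ n] power2_eq_square)
    moreover have "0 < s\<^sup>2 * a * (v \<bullet> v) + t\<^sup>2 * b * (w \<bullet> w)"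
      using st(2) ab scalar_prod_self_pos[OF vn(1,2)] scalar_prod_self_pos[OF wn(1,2)]
      by (cases "s = 0") (auto intro!: add_pos_nonneg)
    ultimately show False by simp
  qed
  let ?E = "{x. eigenvalue A x \<and> 0 < x}"
  have cp: "char_poly A \<noteq> 0" using degree_monic_char_poly[OF A(1)] by auto
  have simple: "Polynomial.order x (char_poly A) \<le> 1" if "x \<in> ?E" for x
  proof (rule ccontr)
    assume "\<not> ?thesis"
    moreover obtain v where "eigenvector A v x" using \<open>x \<in> ?E\<close> unfolding eigenvalue_def by auto
    ultimately obtain w where "eigenvector A w x" "v \<bullet> w = 0"
      using orthogonal_eigenvector_of_multiple_root[OF A, of v x] by auto
    thus False using no_pair[OF \<open>eigenvector A v x\<close>] \<open>x \<in> ?E\<close> by auto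
  qed
  have unique: "x = y" if xy: "x \<in> ?E" "y \<in> ?E" for x y
  proof (rule ccontr)
    assume "x \<noteq> y"
    obtain v w where v: "eigenvector A v x" and w: "eigenvector A w y"
      using xy unfolding eigenvalue_def by auto
    hence c: "v \<in> carrier_vec n" "w \<in> carrier_vec n" "A *\<^sub>v v = x \<cdot>\<^sub>v v" "A *\<^sub>v w = y \<cdot>\<^sub>v w"
      using A unfolding eigenvector_def by auto
    have "y * (v \<bullet> w) = x * (v \<bullet> w)"
      using symmetric_scalar_prod[OF A c(1,2)] c by simp
    hence "v \<bullet> w = 0" using \<open>x \<noteq> y\<close> by simp
    thus False using no_pair[OF v w] xy by auto
  qed
  consider "?E = {}" | x where "?E = {x}" using unique by blast
  thus ?thesis
  proof cases
    case 1
    show ?thesis unfolding num_pos_eigenvalues_def 1 by simp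
  next
    case (2 x)
    show ?thesis unfolding num_pos_eigenvalues_def 2 using simple[of x] 2 by auto
  qed
qed

section \<open>The scaled matrix is a near-ultrametric\<close>

text \<open>\<open>(t + b) powr q - t powr q\<close> is antitone in \<open>t > 0\<close>; compare \<open>t = a\<close> with \<open>t = b\<close>.\<close>

lemma powr_add_le:
  fixes a b q :: real
  assumes "0 < b" "b \<le> a" "0 \<le> q" "q \<le> 1"
  shows "(a + b) powr q \<le> a powr q + (2 powr q - 1) * b powr q"
proof -
  have "(a + b) powr q - a powr q \<le> (b + b) powr q - b powr q"
  proof (rule DERIV_nonpos_imp_nonincreasing[OF \<open>b \<le> a\<close>, of "\<lambda>t. (t + b) powr q - t powr q"])
    fix t assume t: "b \<le> t" "t \<le> a"
    hence "0 < t" using assms by simp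
    have "((\<lambda>t. (t + b) powr q - t powr q) has_real_derivative
        q * (t + b) powr (q - 1) - q * t powr (q - 1)) (at t)"
      using \<open>0 < t\<close> assms by (auto intro!: derivative_eq_intros)
    moreover have "(t + b) powr (q - 1) \<le> t powr (q - 1)"
      using \<open>0 < t\<close> assms by (intro powr_mono2') auto
    hence "q * (t + b) powr (q - 1) - q * t powr (q - 1) \<le> 0"
      using assms by (simp add: mult_left_mono)
    ultimately show "\<exists>y. ((\<lambda>t. (t + b) powr q - t powr q) has_real_derivative y) (at t) \<and> y \<le> 0"
      by blast
  qed
  moreover have "(b + b) powr q = 2 powr q * b powr q"
    using powr_mult[of 2 b q] assms by simp
  ultimately show ?thesis by (simp add: algebra_simps)
qed

lemma metric_power_near_ultrametric:
  fixes a b c q :: real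
  assumes q: "0 < q" "q \<le> 1" and pos: "0 < a" "0 < b" "0 < c" and "a \<le> b"
    and tri: "c powr (1 / q) \<le> a powr (1 / q) + b powr (1 / q)"
  shows "c \<le> b + (2 powr q - 1) * a"
proof -
  have inv: "(t powr (1 / q)) powr q = t" if "0 < t" for t
    using that q by (simp add: powr_powr)
  have "c = (c powr (1 / q)) powr q" using inv pos by simp
  also have "\<dots> \<le> (b powr (1 / q) + a powr (1 / q)) powr q"
    using tri q by (intro powr_mono2) auto
  also have "\<dots> \<le> (b powr (1 / q)) powr q + (2 powr q - 1) * (a powr (1 / q)) powr q"
    using pos q \<open>a \<le> b\<close> by (intro powr_add_le powr_mono2) auto
  finally show ?thesis using inv pos by simp
qed

text \<open>Scaling rows and columns so that row \<open>0\<close> becomes constantly \<open>1\<close> off the diagonal turns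
  the inequality for the indices \<open>0, j, k, l\<close> into the triangle inequality for \<open>j, k, l\<close>.\<close>

lemma Tq_inequalities_metric:
  fixes A :: "real mat"
  assumes A: "A \<in> carrier_mat n n" "transpose_mat A = A"
    and pos: "\<And>i j. i < n \<Longrightarrow> j < n \<Longrightarrow> i \<noteq> j \<Longrightarrow> A $$ (i, j) > 0"
    and T: "Tq_inequalities q A"
    and ijk: "i \<in> {1..<n}" "j \<in> {1..<n}" "k \<in> {1..<n}" "i \<noteq> j" "j \<noteq> k" "i \<noteq> k"
  defines "B \<equiv> \<lambda>i j. A $$ (i, j) / (A $$ (0, i) * A $$ (0, j))"
  shows "B i k powr (1 / q) \<le> B i j powr (1 / q) + B j k powr (1 / q)"
proof -
  have sym: "A $$ (i, j) = A $$ (j, i)" if "i < n" "j < n" for i j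
    using A that by (metis carrier_matD index_transpose_mat(1))
  define D where "D = (\<lambda>i j. B i j powr (1 / q))"
  have D_sym: "D i j = D j i" if "i < n" "j < n" for i j
    unfolding D_def B_def using sym that by (simp add: mult.commute)
  have sorted: "triangle_sides (D k l) (D j l) (D j k)"
    if "0 < j" "j < k" "k < l" "l < n" for j k l
  proof -
    define c where "c = A $$ (0, j) * A $$ (0, k) * A $$ (0, l)"
    have p: "0 < A $$ (0, j)" "0 < A $$ (0, k)" "0 < A $$ (0, l)" using pos that by auto
    hence "0 < c" unfolding c_def by simp
    have B0: "0 \<le> B j k" "0 \<le> B j l" "0 \<le> B k l"
      using pos[of j k] pos[of j l] pos[of k l] p that unfolding B_def by simp_all
    have eqs: "A $$ (0, j) * A $$ (k, l) = c * B k l" "A $$ (0, k) * A $$ (j, l) = c * B j l"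
      "A $$ (0, l) * A $$ (j, k) = c * B j k"
      unfolding B_def c_def using p by (simp_all add: field_simps)
    have "triangle_sides ((A $$ (0, j) * A $$ (k, l)) powr (1 / q))
        ((A $$ (0, k) * A $$ (j, l)) powr (1 / q)) ((A $$ (0, l) * A $$ (j, k)) powr (1 / q))"
      using T that A unfolding Tq_inequalities_def by auto
    hence "triangle_sides (c powr (1 / q) * D k l) (c powr (1 / q) * D j l) (c powr (1 / q) * D j k)"
      unfolding eqs D_def using B0 \<open>0 < c\<close> by (simp add: powr_mult)
    moreover have "0 < c powr (1 / q)" using \<open>0 < c\<close> by simp
    ultimately show ?thesis
      unfolding triangle_sides_def by (simp add: distrib_left[symmetric])
  qed
  have lt: "i < n" "j < n" "k < n" "0 < i" "0 < j" "0 < k" using ijk by auto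
  consider "i < j" "j < k" | "i < k" "k < j" | "j < i" "i < k" | "j < k" "k < i"
    | "k < i" "i < j" | "k < j" "j < i"
    using ijk(4-) by linarith
  hence "D i k \<le> D i j + D j k"
    by cases (use sorted[of i j k] sorted[of i k j] sorted[of j i k] sorted[of j k i]
        sorted[of k i j] sorted[of k j i] lt D_sym[of i j] D_sym[of j k] D_sym[of i k]
        in \<open>simp_all add: triangle_sides_def\<close>)
  thus ?thesis unfolding D_def .
qed

lemma near_ultrametric_of_Tq:
  fixes A :: "real mat"
  assumes A: "A \<in> carrier_mat n n" "transpose_mat A = A"
    and diag: "\<And>i. i < n \<Longrightarrow> A $$ (i, i) = 0"
    and pos: "\<And>i j. i < n \<Longrightarrow> j < n \<Longrightarrow> i \<noteq> j \<Longrightarrow> A $$ (i, j) > 0"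
    and q: "0 < q" "q \<le> 1" and T: "Tq_inequalities q A"
  shows "near_ultrametric_on {1..<n} (2 powr q - 1)
           (\<lambda>i j. A $$ (i, j) / (A $$ (0, i) * A $$ (0, j)))"
proof -
  define B where "B = (\<lambda>i j. A $$ (i, j) / (A $$ (0, i) * A $$ (0, j)))"
  have p: "0 < A $$ (0, i)" if "i \<in> {1..<n}" for i using pos[of 0 i] that by auto
  have Bpos: "0 < B i j" if "i \<in> {1..<n}" "j \<in> {1..<n}" "i \<noteq> j" for i j
    using p[OF that(1)] p[OF that(2)] pos[of i j] that unfolding B_def by simp
  have B0: "B i i = 0" if "i \<in> {1..<n}" for i using that diag unfolding B_def by simp
  have Bnn: "0 \<le> B i j" if "i \<in> {1..<n}" "j \<in> {1..<n}" for i j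
    using Bpos[OF that] B0[OF that(1)] by (cases "i = j") auto
  have sym: "A $$ (i, j) = A $$ (j, i)" if "i < n" "j < n" for i j
    using A that by (metis carrier_matD index_transpose_mat(1))
  have B_sym: "B i j = B j i" if "i \<in> {1..<n}" "j \<in> {1..<n}" for i j
    using sym[of i j] that unfolding B_def by (simp add: mult.commute)
  have e: "0 \<le> 2 powr q - 1" using q ge_one_powr_ge_zero[of 2 q] by simp
  have "B i k \<le> B j k + (2 powr q - 1) * B i j"
    if ijk: "i \<in> {1..<n}" "j \<in> {1..<n}" "k \<in> {1..<n}" and le: "B i j \<le> B j k" for i j k
  proof -
    consider "i = j" | "j = k" "i \<noteq> j" | "i = k" | "i \<noteq> j" "j \<noteq> k" "i \<noteq> k" by blast
    thus ?thesis
    proof cases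
      case 1
      thus ?thesis using B0 ijk by simp
    next
      case 2
      thus ?thesis using le Bpos[of i j] B0 ijk by simp
    next
      case 3
      thus ?thesis using B0 Bnn e ijk by simp
    next
      case 4
      show ?thesis
        using Tq_inequalities_metric[OF A pos T ijk 4(1,2,3)] Bpos ijk 4 le
        unfolding B_def[symmetric] by (intro metric_power_near_ultrametric[OF q]) (auto simp: B_def)
    qed
  qed
  hence "near_ultrametric_on {1..<n} (2 powr q - 1) B"
    unfolding near_ultrametric_on_def using Bnn B_sym B0 by blast
  thus ?thesis unfolding B_def .
qed

section \<open>The Lorentzian property\<close>

theorem theorem1p2:
  fixes n :: nat and q :: real and A :: "real mat"
  assumes "n \<ge> 4"
    and "A \<in> carrier_mat n n"
    and "transpose_mat A = A"
    and "\<And>i. i < n \<Longrightarrow> A $$ (i, i) = 0"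
    and "\<And>i j. i < n \<Longrightarrow> j < n \<Longrightarrow> i \<noteq> j \<Longrightarrow> A $$ (i, j) > 0"
    and "0 < q" and "q \<le> eps n"
    and "Tq_inequalities q A"
  shows "lorentzian A"
proof -
  note A = assms(2,3) and diag = assms(4) and pos = assms(5)
  define S where "S = {1..<n}"
  define e where "e = (2::real) powr q - 1"
  have n: "4 \<le> real n" using assms(1) by simp
  have "2 powr q \<le> 2 powr eps n" using assms(7) by simp
  also have "\<dots> = 1 + 1 / (real n - 2)" unfolding eps_def using n by (simp add: add_pos_pos)
  finally have e_le: "e \<le> 1 / (real n - 2)" unfolding e_def by simp
  also have "\<dots> \<le> 1" using n by simp
  finally have "2 powr q \<le> 2 powr (1::real)" unfolding e_def by simp
  hence "q \<le> 1" by (subst (asm) powr_le_cancel_iff) auto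
  have "0 \<le> e" unfolding e_def using assms(6) ge_one_powr_ge_zero[of 2 q] by simp
  have card: "real (card S) = real n - 1" unfolding S_def using n by simp
  \<comment> \<open>\<open>e \<le> 1 / (n - 2)\<close> is stronger than what negative type needs, which is
    \<open>e \<le> 2 / (n - 3)\<close>, as \<open>S\<close> has \<open>n - 1\<close> elements.\<close>
  have "e * (real (card S) - 2) \<le> e * (real n - 2)"
    using \<open>0 \<le> e\<close> by (intro mult_left_mono) (auto simp: card)
  also have "\<dots> \<le> 1" using e_le n by (simp add: field_simps)
  finally have e_card: "e * (real (card S) - 2) \<le> 2" by simp
  define B where "B = (\<lambda>i j. A $$ (i, j) / (A $$ (0, i) * A $$ (0, j)))"
  have nu: "near_ultrametric_on S e B"
    unfolding S_def e_def B_def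
    by (rule near_ultrametric_of_Tq[OF A diag pos assms(6) \<open>q \<le> 1\<close> assms(8)])
  have "x \<bullet> (A *\<^sub>v x) \<le> 0" if x: "x \<in> carrier_vec n" and lx: "row A 0 \<bullet> x = 0" for x
  proof -
    \<comment> \<open>In the variables \<open>z\<close> the hyperplane condition becomes \<open>\<Sum> z = 0\<close>, and the form becomes that
      of the scaled matrix \<open>B\<close>, because the terms with an index \<open>0\<close> vanish by that condition.\<close>
    define z where "z = (\<lambda>i. A $$ (0, i) * x $ i)"
    have split: "{0..<n} = insert 0 S" "finite S" "0 \<notin> S" unfolding S_def using n by auto
    have A00: "A $$ (0, 0) = 0" using diag n by simp
    have sym: "A $$ (i, 0) = A $$ (0, i)" if "i < n" for i
      using A that n by (metis carrier_matD index_transpose_mat(1) gr_zeroI not_less_zero)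
    have nz: "A $$ (0, i) \<noteq> 0" if "i \<in> S" for i using pos[of 0 i] that unfolding S_def by force
    have "(\<Sum>i\<in>S. z i) = row A 0 \<bullet> x"
      using x A n split A00 by (auto simp: scalar_prod_def z_def S_def intro!: sum.cong)
    hence z0: "(\<Sum>i\<in>S. z i) = 0" using lx by simp
    have "x \<bullet> (A *\<^sub>v x) = (\<Sum>i\<in>{0..<n}. \<Sum>j\<in>{0..<n}. A $$ (i, j) * x $ i * x $ j)"
      using x A by (auto simp: scalar_prod_def sum_distrib_left mult_ac intro!: sum.cong)
    also have "\<dots> = x $ 0 * (\<Sum>j\<in>S. z j) + (\<Sum>i\<in>S. A $$ (i, 0) * x $ i) * x $ 0
        + (\<Sum>i\<in>S. \<Sum>j\<in>S. A $$ (i, j) * x $ i * x $ j)"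
      unfolding split(1) using split(2,3)
      by (simp add: A00 z_def sum.distrib sum_distrib_left sum_distrib_right mult_ac)
    also have "(\<Sum>i\<in>S. A $$ (i, 0) * x $ i) = (\<Sum>i\<in>S. z i)"
      unfolding z_def by (intro sum.cong) (auto simp: sym S_def)
    also have "(\<Sum>i\<in>S. \<Sum>j\<in>S. A $$ (i, j) * x $ i * x $ j) = (\<Sum>i\<in>S. \<Sum>j\<in>S. B i j * z i * z j)"
      unfolding B_def z_def using nz by (intro sum.cong) auto
    finally show ?thesis
      using near_ultrametric_negative_type[OF split(2) \<open>0 \<le> e\<close> e_card nu z0] z0 by simp
  qed
  hence "num_pos_eigenvalues A \<le> 1"
    using A by (intro at_most_one_positive_eigenvalue[OF A, of "row A 0"]) auto
  moreover have "0 \<le> A $$ (i, j)" if "i < n" "j < n" for i j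
    using diag pos[of i j] that by (cases "i = j") auto
  ultimately show ?thesis unfolding lorentzian_def using A by simp
qed

end
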